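(* Every direct summand of a weakly $\delta$-quasipolar ring is weakly $\delta$-quasipolar. That is, if a weakly $\delta$-quasipolar ring $R$ is a direct product of rings $R\cong S\times T$, then $S$ is weakly $\delta$-quasipolar.
   Context: All rings are associative with identity. For $a\in R$, $comm(a)=\{x\in R \mid xa=ax\}$. A right ideal $I$ of $R$ is $\delta$-small if whenever $R=I+K$ with $K$ a right ideal such that $R/K$ is a singular right $R$-module, then $R=K$. $\delta(R)$ is the sum of all $\delta$-small right ideals of $R$; it is a two-sided ideal and equals the intersection of all essential maximal right ideals of $R$ (equal to $R$ if there are none). An element $a\in R$ is weakly $\delta$-quasipolar if there exists $p^2=p\in comm(a)$ such that $a+p\in\delta(R)$; $R$ is weakly $\delta$-quasipolar if every element of $R$ is. *)

theory Defs
  imports "HOL-Algebra.Chinese_Remainder" "HOL-Algebra.Generated_Groups" "HOL-Algebra.Module"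
begin

text \<open>
  The rings of \<^theory>\<open>HOL-Algebra.Ring\<close> are associative and unital, and the zero ring is allowed.
\<close>

section \<open>Right ideals and right modules\<close>

locale right_ideal = additive_subgroup I R + ring R for I and R (structure) +
  assumes I_r_closed: "\<lbrakk>a \<in> I; x \<in> carrier R\<rbrakk> \<Longrightarrow> a \<otimes> x \<in> I"

definition essential_right_ideal :: "'a set \<Rightarrow> ('a, 'm) ring_scheme \<Rightarrow> bool"
  where "essential_right_ideal I R \<longleftrightarrow>
    right_ideal I R \<and> (\<forall>J. right_ideal J R \<and> J \<noteq> {\<zero>\<^bsub>R\<^esub>} \<longrightarrow> I \<inter> J \<noteq> {\<zero>\<^bsub>R\<^esub>})"

text \<open>
  The locale \<^locale>\<open>module\<close> is about commutative rings, so only its record type is reused here.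
  The scalar is written on the left: \<open>r \<odot>\<^bsub>M\<^esub> m\<close> stands for the right action \<open>m r\<close>, whence
  the order of the factors in \<open>smult_assoc\<close>.
\<close>

locale right_module = R?: ring R + M?: abelian_group M
  for R :: "('a, 'm) ring_scheme" (structure) and M :: "('a, 'b, 'n) module_scheme" (structure) +
  assumes smult_closed:
      "\<lbrakk>r \<in> carrier R; x \<in> carrier M\<rbrakk> \<Longrightarrow> r \<odot>\<^bsub>M\<^esub> x \<in> carrier M"
    and smult_l_distr:
      "\<lbrakk>r \<in> carrier R; s \<in> carrier R; x \<in> carrier M\<rbrakk> \<Longrightarrow>
       (r \<oplus>\<^bsub>R\<^esub> s) \<odot>\<^bsub>M\<^esub> x = r \<odot>\<^bsub>M\<^esub> x \<oplus>\<^bsub>M\<^esub> s \<odot>\<^bsub>M\<^esub> x"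
    and smult_r_distr:
      "\<lbrakk>r \<in> carrier R; x \<in> carrier M; y \<in> carrier M\<rbrakk> \<Longrightarrow>
       r \<odot>\<^bsub>M\<^esub> (x \<oplus>\<^bsub>M\<^esub> y) = r \<odot>\<^bsub>M\<^esub> x \<oplus>\<^bsub>M\<^esub> r \<odot>\<^bsub>M\<^esub> y"
    and smult_assoc:
      "\<lbrakk>r \<in> carrier R; s \<in> carrier R; x \<in> carrier M\<rbrakk> \<Longrightarrow>
       (r \<otimes>\<^bsub>R\<^esub> s) \<odot>\<^bsub>M\<^esub> x = s \<odot>\<^bsub>M\<^esub> (r \<odot>\<^bsub>M\<^esub> x)"
    and smult_one:
      "x \<in> carrier M \<Longrightarrow> \<one>\<^bsub>R\<^esub> \<odot>\<^bsub>M\<^esub> x = x"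

definition right_annihilator ::
    "('a, 'm) ring_scheme \<Rightarrow> ('a, 'b, 'n) module_scheme \<Rightarrow> 'b \<Rightarrow> 'a set"
  where "right_annihilator R M x = {r \<in> carrier R. r \<odot>\<^bsub>M\<^esub> x = \<zero>\<^bsub>M\<^esub>}"

definition singular_submodule ::
    "('a, 'm) ring_scheme \<Rightarrow> ('a, 'b, 'n) module_scheme \<Rightarrow> 'b set"
  where "singular_submodule R M =
    {x \<in> carrier M. essential_right_ideal (right_annihilator R M x) R}"

definition singular_right_module ::
    "('a, 'm) ring_scheme \<Rightarrow> ('a, 'b, 'n) module_scheme \<Rightarrow> bool"
  where "singular_right_module R M \<longleftrightarrow>
    right_module R M \<and> singular_submodule R M = carrier M"

text \<open>
  The right module \<open>R/K\<close>; the action is \<open>(K + x) r = K + x r\<close>, written as a union over the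
  representatives as in \<^const>\<open>rcoset_mult\<close>. The fields \<open>mult\<close> and \<open>one\<close> of the
  record play no role for modules.
\<close>

definition quotient_right_module ::
    "('a, 'm) ring_scheme \<Rightarrow> 'a set \<Rightarrow> ('a, 'a set) module"
  where "quotient_right_module R K =
    \<lparr>carrier = a_rcosets\<^bsub>R\<^esub> K, mult = undefined, one = undefined,
     zero = K, add = set_add R, smult = (\<lambda>r C. \<Union>x\<in>C. K +>\<^bsub>R\<^esub> (x \<otimes>\<^bsub>R\<^esub> r))\<rparr>"

context right_ideal
begin

lemma abelian_subgroup_I: "abelian_subgroup I R"
  by (intro abelian_subgroupI3 additive_subgroup_axioms) (rule abelian_group_axioms)

lemma quotient_smult:
  assumes x: "x \<in> carrier R" and r: "r \<in> carrier R"
  shows "r \<odot>\<^bsub>quotient_right_module R I\<^esub> (I +> x) = I +> (x \<otimes> r)"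
proof -
  interpret abelian_subgroup I R by (rule abelian_subgroup_I)
  have "I +> (y \<otimes> r) = I +> (x \<otimes> r)" if y: "y \<in> I +> x" for y
  proof -
    obtain i where i: "i \<in> I" "y = i \<oplus> x"
      using y by (auto simp: a_r_coset_def')
    have "y \<otimes> r = i \<otimes> r \<oplus> x \<otimes> r"
      using i x r by (simp add: l_distr)
    then have "y \<otimes> r \<in> I +> (x \<otimes> r)"
      using I_r_closed[OF i(1) r] by (auto simp: a_r_coset_def')
    then show ?thesis
      using a_repr_independence' x r by (metis m_closed)
  qed
  moreover have "x \<in> I +> x"
    using x by (rule a_rcos_self)
  ultimately have "(\<Union>y\<in>I +> x. I +> (y \<otimes> r)) = I +> (x \<otimes> r)"
    by blast
  then show ?thesis
    by (simp add: quotient_right_module_def)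
qed

lemma quotient_is_right_module: "right_module R (quotient_right_module R I)"
proof -
  interpret abelian_subgroup I R by (rule abelian_subgroup_I)
  let ?Q = "quotient_right_module R I"
  have carr: "carrier ?Q = a_rcosets I" and add: "add ?Q = set_add R"
    by (simp_all add: quotient_right_module_def)
  have rep: "\<exists>x \<in> carrier R. C = I +> x" if "C \<in> carrier ?Q" for C
    using that by (auto simp: carr A_RCOSETS_def')
  have closed: "I +> x \<in> carrier ?Q" if "x \<in> carrier R" for x
    using that by (auto simp: carr A_RCOSETS_def')
  have sm: "r \<odot>\<^bsub>?Q\<^esub> (I +> x) = I +> (x \<otimes> r)" if "r \<in> carrier R" "x \<in> carrier R" for r x
    using that quotient_smult by blast
  have ad: "(I +> x) \<oplus>\<^bsub>?Q\<^esub> (I +> y) = I +> (x \<oplus> y)" if "x \<in> carrier R" "y \<in> carrier R" for x y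
    using that by (simp add: add a_rcos_sum)
  have zero: "\<zero>\<^bsub>?Q\<^esub> = I +> \<zero>"
    by (simp add: quotient_right_module_def a_coset_add_zero a_subset)
  have grp: "abelian_group ?Q"
  proof (rule abelian_groupI)
    show "\<zero>\<^bsub>?Q\<^esub> \<in> carrier ?Q"
      unfolding zero by (rule closed) (rule zero_closed)
  next
    fix C assume "C \<in> carrier ?Q"
    from rep[OF this] obtain x where x: "x \<in> carrier R" "C = I +> x" by blast
    show "\<zero>\<^bsub>?Q\<^esub> \<oplus>\<^bsub>?Q\<^esub> C = C"
      using x(1) unfolding x(2) zero by (simp only: ad l_zero zero_closed)
    have "(I +> \<ominus> x) \<oplus>\<^bsub>?Q\<^esub> C = \<zero>\<^bsub>?Q\<^esub>"
      using x(1) unfolding x(2) zero by (simp only: ad l_neg a_inv_closed)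
    then show "\<exists>D \<in> carrier ?Q. D \<oplus>\<^bsub>?Q\<^esub> C = \<zero>\<^bsub>?Q\<^esub>"
      using closed[OF a_inv_closed[OF x(1)]] by blast
  next
    fix C D assume C: "C \<in> carrier ?Q" and D: "D \<in> carrier ?Q"
    from rep[OF C] obtain x where x: "x \<in> carrier R" "C = I +> x" by blast
    from rep[OF D] obtain y where y: "y \<in> carrier R" "D = I +> y" by blast
    show "C \<oplus>\<^bsub>?Q\<^esub> D \<in> carrier ?Q"
      using x(1) y(1) closed unfolding x(2) y(2) by (simp only: ad a_closed)
    show "C \<oplus>\<^bsub>?Q\<^esub> D = D \<oplus>\<^bsub>?Q\<^esub> C"
      using x(1) y(1) a_comm[OF x(1) y(1)] unfolding x(2) y(2) by (simp only: ad)
    fix E assume E: "E \<in> carrier ?Q"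
    from rep[OF E] obtain z where z: "z \<in> carrier R" "E = I +> z" by blast
    show "(C \<oplus>\<^bsub>?Q\<^esub> D) \<oplus>\<^bsub>?Q\<^esub> E = C \<oplus>\<^bsub>?Q\<^esub> (D \<oplus>\<^bsub>?Q\<^esub> E)"
      using x(1) y(1) z(1) unfolding x(2) y(2) z(2) by (simp only: ad a_closed a_assoc)
  qed
  show ?thesis
  proof (intro right_module.intro right_module_axioms.intro ring_axioms grp)
    fix r C assume r: "r \<in> carrier R" and C: "C \<in> carrier ?Q"
    from rep[OF C] r show "r \<odot>\<^bsub>?Q\<^esub> C \<in> carrier ?Q"
      by (metis closed m_closed sm)
  next
    fix r s C assume r: "r \<in> carrier R" and s: "s \<in> carrier R" and C: "C \<in> carrier ?Q"
    from rep[OF C] obtain x where x: "x \<in> carrier R" "C = I +> x" by blast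
    show "(r \<oplus> s) \<odot>\<^bsub>?Q\<^esub> C = r \<odot>\<^bsub>?Q\<^esub> C \<oplus>\<^bsub>?Q\<^esub> s \<odot>\<^bsub>?Q\<^esub> C"
      using r s x(1) unfolding x(2) by (simp only: sm ad r_distr a_closed m_closed)
    show "(r \<otimes> s) \<odot>\<^bsub>?Q\<^esub> C = s \<odot>\<^bsub>?Q\<^esub> (r \<odot>\<^bsub>?Q\<^esub> C)"
      using r s x(1) unfolding x(2) by (simp only: sm m_assoc m_closed)
  next
    fix r C D assume r: "r \<in> carrier R" and C: "C \<in> carrier ?Q" and D: "D \<in> carrier ?Q"
    from rep[OF C] obtain x where x: "x \<in> carrier R" "C = I +> x" by blast
    from rep[OF D] obtain y where y: "y \<in> carrier R" "D = I +> y" by blast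
    show "r \<odot>\<^bsub>?Q\<^esub> (C \<oplus>\<^bsub>?Q\<^esub> D) = r \<odot>\<^bsub>?Q\<^esub> C \<oplus>\<^bsub>?Q\<^esub> r \<odot>\<^bsub>?Q\<^esub> D"
      using r x(1) y(1) unfolding x(2) y(2) by (simp only: sm ad l_distr a_closed m_closed)
  next
    fix C assume C: "C \<in> carrier ?Q"
    from rep[OF C] obtain x where x: "x \<in> carrier R" "C = I +> x" by blast
    show "\<one> \<odot>\<^bsub>?Q\<^esub> C = C"
      using x(1) unfolding x(2) by (simp only: sm r_one one_closed)
  qed
qed

end

section \<open>Weakly delta-quasipolar rings\<close>

definition delta_small :: "'a set \<Rightarrow> ('a, 'm) ring_scheme \<Rightarrow> bool"
  where "delta_small I R \<longleftrightarrow>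
    right_ideal I R \<and>
    (\<forall>K. right_ideal K R \<and> singular_right_module R (quotient_right_module R K) \<and>
         carrier R = I <+>\<^bsub>R\<^esub> K \<longrightarrow> carrier R = K)"

text \<open>
  A sum of right ideals consists of the finite sums of their elements, that is, it is the additive
  subgroup generated by their union.
\<close>

definition delta :: "('a, 'm) ring_scheme \<Rightarrow> 'a set"
  where "delta R = generate (add_monoid R) (\<Union>{I. delta_small I R})"

definition comm :: "('a, 'm) ring_scheme \<Rightarrow> 'a \<Rightarrow> 'a set"
  where "comm R a = {x \<in> carrier R. x \<otimes>\<^bsub>R\<^esub> a = a \<otimes>\<^bsub>R\<^esub> x}"

definition weakly_delta_quasipolar_element :: "('a, 'm) ring_scheme \<Rightarrow> 'a \<Rightarrow> bool"
  where "weakly_delta_quasipolar_element R a \<longleftrightarrow>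
    (\<exists>p \<in> comm R a. p \<otimes>\<^bsub>R\<^esub> p = p \<and> a \<oplus>\<^bsub>R\<^esub> p \<in> delta R)"

definition weakly_delta_quasipolar :: "('a, 'm) ring_scheme \<Rightarrow> bool"
  where "weakly_delta_quasipolar R \<longleftrightarrow>
    (\<forall>a \<in> carrier R. weakly_delta_quasipolar_element R a)"

end

theory Submission
  imports Defs
begin

text \<open>
  Only a surjective homomorphism \<open>h : R \<rightarrow> S\<close> is needed, namely \<open>R \<simeq> S \<times> T \<rightarrow> S\<close>. Preimages of
  essential right ideals under \<open>h\<close> are essential: a right ideal \<open>J\<close> that meets such a preimage
  trivially meets the kernel trivially, so \<open>h\<close> is injective on \<open>J\<close>, and \<open>h(J)\<close> meets the essential
  right ideal trivially. Hence \<open>R/h\<inverse>(K)\<close> is singular whenever \<open>S/K\<close> is, so \<open>h\<close> maps \<open>\<delta>\<close>-small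
  right ideals to \<open>\<delta>\<close>-small ones and \<open>\<delta>(R)\<close> into \<open>\<delta>(S)\<close>. Idempotents in \<open>comm(a)\<close> are mapped to
  idempotents in \<open>comm(h(a))\<close>.
\<close>

section \<open>Right ideals and singular quotient modules\<close>

lemma (in ring) right_idealI:
  assumes sub: "I \<subseteq> carrier R" and zero: "\<zero> \<in> I"
    and add: "\<And>x y. \<lbrakk>x \<in> I; y \<in> I\<rbrakk> \<Longrightarrow> x \<oplus> y \<in> I"
    and mult: "\<And>x r. \<lbrakk>x \<in> I; r \<in> carrier R\<rbrakk> \<Longrightarrow> x \<otimes> r \<in> I"
  shows "right_ideal I R"
proof -
  \<comment> \<open>Negation is right multiplication by -1.\<close>
  have "\<ominus> x \<in> I" if "x \<in> I" for x
    using mult[OF that, of "\<ominus> \<one>"] sub that by (auto simp: r_minus)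
  then have "subgroup I (add_monoid R)"
    using sub zero add by (intro add.subgroupI) (auto simp: a_inv_def)
  then show ?thesis
    by (intro right_ideal.intro additive_subgroupI right_ideal_axioms.intro ring_axioms mult)
qed

context right_ideal
begin

lemma right_annihilator_quotient:
  assumes x: "x \<in> carrier R"
  shows "right_annihilator R (quotient_right_module R I) (I +> x)
    = {r \<in> carrier R. x \<otimes> r \<in> I}"
proof -
  interpret abelian_subgroup I R by (rule abelian_subgroup_I)
  have "I +> (x \<otimes> r) = I \<longleftrightarrow> x \<otimes> r \<in> I" if "r \<in> carrier R" for r
    using m_closed[OF x that] a_coset_join1[OF _ _ a_subgroup] a_coset_join2[OF _ a_subgroup] by blast
  moreover have "\<zero>\<^bsub>quotient_right_module R I\<^esub> = I"
    by (simp add: quotient_right_module_def)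
  ultimately show ?thesis
    using x by (simp add: right_annihilator_def quotient_smult cong: conj_cong)
qed

text \<open>Every element of the quotient is a coset of some \<open>x\<close>, and its annihilator
  is known. In this form singularity can be moved along a ring homomorphism without a map between
  quotient modules.\<close>

lemma singular_quotient_iff:
  "singular_right_module R (quotient_right_module R I) \<longleftrightarrow>
    (\<forall>x \<in> carrier R. essential_right_ideal {r \<in> carrier R. x \<otimes> r \<in> I} R)"
proof -
  have "carrier (quotient_right_module R I) = (\<lambda>x. I +> x) ` carrier R"
    by (auto simp: quotient_right_module_def A_RCOSETS_def')
  moreover have "{x \<in> A. P x} = A \<longleftrightarrow> (\<forall>x \<in> A. P x)" for A :: "'a set set" and P
    by blast
  ultimately show ?thesis
    using quotient_is_right_module
    by (simp add: singular_right_module_def singular_submodule_def right_annihilator_quotient)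
qed

end

section \<open>Transport along a ring homomorphism\<close>

context ring_hom_ring
begin

lemma right_ideal_vimage:
  assumes "right_ideal K S"
  shows "right_ideal {x \<in> carrier R. h x \<in> K} R"
proof -
  interpret K: right_ideal K S by fact
  show ?thesis
    by (rule R.right_idealI) (auto simp: K.I_r_closed)
qed

lemma right_ideal_image:
  assumes "right_ideal I R" and surj: "h ` carrier R = carrier S"
  shows "right_ideal (h ` I) S"
proof -
  interpret I: right_ideal I R by fact
  note sub = I.a_subset[THEN subsetD]
  show ?thesis
  proof (rule S.right_idealI)
    show "h ` I \<subseteq> carrier S"
      using sub by auto
    show "\<zero>\<^bsub>S\<^esub> \<in> h ` I"
      using I.zero_closed hom_zero by (metis imageI)
  next
    fix x y assume "x \<in> h ` I" "y \<in> h ` I"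
    then obtain i j where "i \<in> I" "j \<in> I" "x = h i" "y = h j" by blast
    then show "x \<oplus>\<^bsub>S\<^esub> y \<in> h ` I"
      using sub I.a_closed hom_add by (metis imageI)
  next
    fix x s assume "x \<in> h ` I" "s \<in> carrier S"
    \<comment> \<open>Surjectivity lifts the scalar \<open>s\<close> to some \<open>r\<close>, so
      the product is the image of \<open>i\<close> times \<open>r\<close>.\<close>
    then obtain i r where "i \<in> I" "r \<in> carrier R" "x = h i" "s = h r"
      using surj by blast
    then show "x \<otimes>\<^bsub>S\<^esub> s \<in> h ` I"
      using sub I.I_r_closed hom_mult by (metis imageI)
  qed
qed

lemma essential_right_ideal_vimage:
  assumes ess: "essential_right_ideal E S" and surj: "h ` carrier R = carrier S"
  shows "essential_right_ideal {x \<in> carrier R. h x \<in> E} R" (is "essential_right_ideal ?E R")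
  unfolding essential_right_ideal_def
proof (intro conjI allI impI notI)
  from ess have E: "right_ideal E S"
    by (simp add: essential_right_ideal_def)
  interpret E: right_ideal E S by (rule E)
  show "right_ideal ?E R"
    by (rule right_ideal_vimage) (rule E)
  fix J assume J: "right_ideal J R \<and> J \<noteq> {\<zero>\<^bsub>R\<^esub>}" and triv: "?E \<inter> J = {\<zero>\<^bsub>R\<^esub>}"
  interpret J: right_ideal J R using J by simp
  have zero: "j = \<zero>\<^bsub>R\<^esub>" if "j \<in> J" "h j \<in> E" for j
  proof -
    have "j \<in> ?E \<inter> J"
      using that J.a_subset by auto
    then show ?thesis
      unfolding triv by simp
  qed
  \<comment> \<open>If \<open>J\<close> were mapped to zero, it would be mapped into
    \<open>E\<close>, and \<open>zero\<close> would make \<open>J\<close> trivial.\<close>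
  have "h ` J \<noteq> {\<zero>\<^bsub>S\<^esub>}"
  proof
    assume "h ` J = {\<zero>\<^bsub>S\<^esub>}"
    then have "h j \<in> E" if "j \<in> J" for j
      using that E.zero_closed by (metis imageI singletonD)
    then have "J = {\<zero>\<^bsub>R\<^esub>}"
      using zero J.zero_closed by (intro subset_antisym subsetI) auto
    then show False
      using J by simp
  qed
  then have "E \<inter> h ` J \<noteq> {\<zero>\<^bsub>S\<^esub>}"
    using ess right_ideal_image[OF conjunct1[OF J] surj]
    unfolding essential_right_ideal_def by blast
  moreover have "E \<inter> h ` J \<subseteq> {\<zero>\<^bsub>S\<^esub>}"
  proof
    fix y assume "y \<in> E \<inter> h ` J"
    then obtain j where "j \<in> J" "h j \<in> E" "y = h j" by blast
    then show "y \<in> {\<zero>\<^bsub>S\<^esub>}"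
      using zero hom_zero by (metis singletonI)
  qed
  \<comment> \<open>Essentiality compares the intersection with the zero set, so the inclusion just
    shown has to become an equality.\<close>
  moreover have "\<zero>\<^bsub>S\<^esub> \<in> h ` J"
    using J.zero_closed hom_zero by (metis imageI)
  ultimately show False
    using E.zero_closed by (metis Int_iff empty_subsetI insert_subset subset_antisym)
qed

text \<open>Since \<open>h\<close> is multiplicative, the annihilator of the coset of
  \<open>x\<close> modulo the preimage of \<open>K\<close> is the preimage of the annihilator of the
  coset of \<open>h x\<close> modulo \<open>K\<close>, which is essential.\<close>

lemma singular_quotient_vimage:
  assumes K: "right_ideal K S" and surj: "h ` carrier R = carrier S"
    and sing: "singular_right_module S (quotient_right_module S K)"
  shows "singular_right_module R (quotient_right_module R {x \<in> carrier R. h x \<in> K})"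
  unfolding right_ideal.singular_quotient_iff[OF right_ideal_vimage[OF K]]
proof
  fix x assume x: "x \<in> carrier R"
  have "essential_right_ideal {s \<in> carrier S. h x \<otimes>\<^bsub>S\<^esub> s \<in> K} S"
    using sing x right_ideal.singular_quotient_iff[OF K] by simp
  from essential_right_ideal_vimage[OF this surj]
  show "essential_right_ideal
      {r \<in> carrier R. x \<otimes>\<^bsub>R\<^esub> r \<in> {x \<in> carrier R. h x \<in> K}} R"
    using x by (simp cong: conj_cong)
qed

lemma delta_small_image:
  assumes small: "delta_small I R" and surj: "h ` carrier R = carrier S"
  shows "delta_small (h ` I) S"
  unfolding delta_small_def
proof (intro conjI allI impI)
  from small have I: "right_ideal I R"
    by (simp add: delta_small_def)
  interpret I: right_ideal I R by (rule I)
  show "right_ideal (h ` I) S"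
    by (rule right_ideal_image[OF I surj])
  fix K
  assume "right_ideal K S \<and> singular_right_module S (quotient_right_module S K) \<and>
    carrier S = h ` I <+>\<^bsub>S\<^esub> K"
  then have K: "right_ideal K S"
    and sing: "singular_right_module S (quotient_right_module S K)"
    and sum: "carrier S = h ` I <+>\<^bsub>S\<^esub> K"
    by simp_all
  interpret K: right_ideal K S by (rule K)
  let ?K = "{x \<in> carrier R. h x \<in> K}"
  have "carrier R \<subseteq> I <+>\<^bsub>R\<^esub> ?K"
  proof
    fix x assume x: "x \<in> carrier R"
    then have "h x \<in> h ` I <+>\<^bsub>S\<^esub> K"
      unfolding sum[symmetric] by (rule hom_closed)
    then obtain i k where i: "i \<in> I" and k: "k \<in> K" and eq: "h x = h i \<oplus>\<^bsub>S\<^esub> k"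
      by (auto simp: set_add_def')
    have iR: "i \<in> carrier R" and kS: "k \<in> carrier S"
      using i k I.a_subset K.a_subset by auto
    \<comment> \<open>The summand that \<open>x\<close> needs besides \<open>i\<close>; subtracting
      \<open>h i\<close> from \<open>h x\<close> leaves \<open>k\<close>, so it lies in
      \<open>?K\<close>.\<close>
    let ?y = "\<ominus>\<^bsub>R\<^esub> i \<oplus>\<^bsub>R\<^esub> x"
    have "h ?y = k"
    proof -
      have "h ?y = \<ominus>\<^bsub>S\<^esub> h i \<oplus>\<^bsub>S\<^esub> h x"
        using x iR by (simp only: hom_add hom_a_inv R.a_inv_closed)
      also have "\<dots> = k"
        unfolding eq by (rule S.r_neg1) (use iR kS in auto)
      finally show ?thesis .
    qed
    then have y: "?y \<in> ?K"
      using x iR k by simp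
    have "i \<oplus>\<^bsub>R\<^esub> ?y \<in> I <+>\<^bsub>R\<^esub> ?K"
      unfolding set_add_def' by (rule UN_I[OF i], rule UN_I[OF y], rule singletonI)
    then show "x \<in> I <+>\<^bsub>R\<^esub> ?K"
      using x iR by (simp only: R.r_neg2)
  qed
  moreover have "I <+>\<^bsub>R\<^esub> ?K \<subseteq> carrier R"
    using I.a_subset by (auto simp: set_add_def')
  ultimately have "carrier R = I <+>\<^bsub>R\<^esub> ?K"
    by (rule subset_antisym)
  moreover have "right_ideal ?K R" "singular_right_module R (quotient_right_module R ?K)"
    by (rule right_ideal_vimage[OF K], rule singular_quotient_vimage[OF K surj sing])
  ultimately have "carrier R = ?K"
    using small unfolding delta_small_def by blast
  then show "carrier S = K"
    using surj K.a_subset by (metis (no_types, lifting) image_subset_iff mem_Collect_eq subset_antisym)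
qed

text \<open>An additive homomorphism commutes with generating a subgroup, so it suffices to map the
  generators, the elements of \<delta>-small right ideals, to generators.\<close>

lemma delta_image:
  assumes surj: "h ` carrier R = carrier S"
  shows "h ` delta R \<subseteq> delta S"
proof -
  have sub: "\<Union>{I. delta_small I R} \<subseteq> carrier (add_monoid R)"
    by (auto simp: delta_small_def right_ideal_def dest: additive_subgroup.a_subset)
  have "h ` delta R = generate (add_monoid S) (h ` \<Union>{I. delta_small I R})"
    unfolding delta_def by (rule group_hom.generate_img[OF a_group_hom sub, symmetric])
  also have "\<dots> \<subseteq> delta S"
    unfolding delta_def
    by (rule S.add.mono_generate) (use delta_small_image[OF _ surj] in blast)
  finally show ?thesis .
qed

lemma weakly_delta_quasipolar_image:
  assumes R: "weakly_delta_quasipolar R" and surj: "h ` carrier R = carrier S"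
  shows "weakly_delta_quasipolar S"
  unfolding weakly_delta_quasipolar_def
proof
  fix b assume "b \<in> carrier S"
  then obtain a where a: "a \<in> carrier R" "b = h a"
    using surj by blast
  then obtain p where p: "p \<in> carrier R" "p \<otimes>\<^bsub>R\<^esub> a = a \<otimes>\<^bsub>R\<^esub> p"
      "p \<otimes>\<^bsub>R\<^esub> p = p" "a \<oplus>\<^bsub>R\<^esub> p \<in> delta R"
    using R unfolding weakly_delta_quasipolar_def weakly_delta_quasipolar_element_def comm_def
    by blast
  have "h p \<in> comm S b" "h p \<otimes>\<^bsub>S\<^esub> h p = h p"
    \<comment> \<open>As a simp rule, \<open>hom_mult\<close> would reduce these instances to
      trivialities, hence its deletion.\<close>
    using a p hom_mult[OF p(1) a(1)] hom_mult[OF a(1) p(1)] hom_mult[OF p(1) p(1)]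
    by (simp_all add: comm_def del: hom_mult)
  moreover have "b \<oplus>\<^bsub>S\<^esub> h p \<in> delta S"
    using imageI[OF p(4), of h] delta_image[OF surj] a hom_add[OF a(1) p(1)] by auto
  ultimately show "weakly_delta_quasipolar_element S b"
    unfolding weakly_delta_quasipolar_element_def by blast
qed

end

section \<open>Projection from a direct product\<close>

lemma fst_RDirProd_hom: "fst \<in> ring_hom (RDirProd S T) S"
  by (auto simp: ring_hom_def RDirProd_def DirProd_def monoid.defs)

theorem corollary3p5:
  fixes R :: "('a, 'm) ring_scheme" and S :: "('b, 'n) ring_scheme" and T :: "('c, 'k) ring_scheme"
  assumes "ring R" and "ring S" and "ring T"
    and "R \<simeq> RDirProd S T"
    and "weakly_delta_quasipolar R"
  shows "weakly_delta_quasipolar S"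
proof -
  from \<open>R \<simeq> RDirProd S T\<close> obtain g where g: "g \<in> ring_iso R (RDirProd S T)"
    unfolding is_ring_iso_def by blast
  then have "fst \<circ> g \<in> ring_hom R S"
    using ring_hom_trans[OF _ fst_RDirProd_hom] by (auto simp: ring_iso_def)
  then interpret ring_hom_ring R S "fst \<circ> g"
    using \<open>ring R\<close> \<open>ring S\<close> by (intro ring_hom_ringI2)
  \<comment> \<open>Projecting a product of sets onto its first factor is surjective once the second
    factor is inhabited.\<close>
  have "carrier T \<noteq> {}"
    using ring.ring_simprules(6)[OF \<open>ring T\<close>] by blast
  moreover have "g ` carrier R = carrier S \<times> carrier T"
    using g by (simp add: ring_iso_def bij_betw_def RDirProd_carrier)
  ultimately have "(fst \<circ> g) ` carrier R = carrier S"
    by (simp only: image_comp[symmetric] fst_image_times if_False)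
  then show ?thesis
    using weakly_delta_quasipolar_image \<open>weakly_delta_quasipolar R\<close> by blast
qed

end
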